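(* For every positive integer $N$, there exists a (finite simple) graph $G$ such that $fxd(G)-fix(G)\ge N$.
   Context: For a graph $G$, a set $D\subseteq V(G)$ is a fixing set of $G$ if the only automorphism of $G$ that fixes every vertex of $D$ is the identity. The fixing number $fix(G)$ is the minimum cardinality of a fixing set of $G$. The fixed number $fxd(G)$ is the minimum number $k$ such that every subset of $V(G)$ of cardinality $k$ is a fixing set of $G$. *)

theory Defs
  imports "Graph_Theory.Graph_Theory"
begin

text \<open>
  Finite simple graphs are values \<open>G :: 'a pair_pre_digraph\<close> satisfying \<^locale>\<open>pair_graph\<close>:
  the vertex set is finite, and the arc set is a finite, symmetric, irreflexive relation on it,
  so an undirected edge is represented by its two arcs.
\<close>

definition automorphism :: "'a pair_pre_digraph \<Rightarrow> ('a \<Rightarrow> 'a) \<Rightarrow> bool" where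
  "automorphism G f \<longleftrightarrow>
     bij_betw f (pverts G) (pverts G) \<and>
     (\<forall>u\<in>pverts G. \<forall>v\<in>pverts G. (u, v) \<in> parcs G \<longleftrightarrow> (f u, f v) \<in> parcs G)"

text \<open>
  The values of an automorphism outside the vertex set are irrelevant, so being the identity is
  only required on the vertex set.
\<close>

definition fixing_set :: "'a pair_pre_digraph \<Rightarrow> 'a set \<Rightarrow> bool" where
  "fixing_set G D \<longleftrightarrow>
     D \<subseteq> pverts G \<and>
     (\<forall>f. automorphism G f \<and> (\<forall>v\<in>D. f v = v) \<longrightarrow> (\<forall>v\<in>pverts G. f v = v))"

text \<open>
  For a finite graph both minima below are attained: the whole vertex set is a fixing set, and it
  is the only set of vertices of its cardinality.
\<close>

definition fixing_number :: "'a pair_pre_digraph \<Rightarrow> nat" where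
  "fixing_number G = (LEAST k. \<exists>D. fixing_set G D \<and> card D = k)"

definition fixed_number :: "'a pair_pre_digraph \<Rightarrow> nat" where
  "fixed_number G = (LEAST k. \<forall>D. D \<subseteq> pverts G \<and> card D = k \<longrightarrow> fixing_set G D)"

lemma fixing_set_pverts: "fixing_set G (pverts G)"
  by (simp add: fixing_set_def)

lemma fixed_number_le_card:
  assumes "finite (pverts G)"
  shows "fixed_number G \<le> card (pverts G)"
  unfolding fixed_number_def
  by (rule Least_le) (use assms card_subset_eq fixing_set_pverts in blast)

text \<open>Agreement with the isomorphisms of the digraph library:\<close>

lemma automorphism_iff_digraph_isomorphism:
  assumes "pair_graph G"
  shows "automorphism G f \<longleftrightarrow>
    (\<exists>h. pre_digraph.digraph_isomorphism (with_proj G) h \<and>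
         app_iso h (with_proj G) = with_proj G \<and> iso_verts h = f)"
proof
  interpret pair_graph G by fact
  assume a: "automorphism G f"
  then have inj: "inj_on f (pverts G)" and im: "f ` pverts G = pverts G"
    and e: "\<And>u v. u \<in> pverts G \<Longrightarrow> v \<in> pverts G \<Longrightarrow> (u, v) \<in> parcs G \<longleftrightarrow> (f u, f v) \<in> parcs G"
    by (auto simp: automorphism_def bij_betw_def)
  let ?h = "\<lparr> iso_verts = f, iso_arcs = map_prod f f, iso_head = snd, iso_tail = fst \<rparr>"
  have "map_prod f f ` parcs G = parcs G"
  proof (intro equalityI subsetI)
    fix x assume "x \<in> map_prod f f ` parcs G"
    then obtain u v where uv: "(u, v) \<in> parcs G" "x = (f u, f v)" by auto
    with e[of u v] wellformed'[OF uv(1)] show "x \<in> parcs G" by simp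
  next
    fix x assume x: "x \<in> parcs G"
    obtain u v where uv: "x = (u, v)" by (cases x)
    with x have "u \<in> f ` pverts G" "v \<in> f ` pverts G" using im wellformed' by auto
    then obtain u' v' where "u' \<in> pverts G" "v' \<in> pverts G" "u = f u'" "v = f v'" by blast
    with e[of u' v'] x uv have "(u', v') \<in> parcs G" "x = map_prod f f (u', v')" by simp_all
    then show "x \<in> map_prod f f ` parcs G" by (rule rev_image_eqI)
  qed
  then have "app_iso ?h (with_proj G) = with_proj G"
    using im by (simp add: app_iso_def with_proj_def)
  moreover have "inj_on (map_prod f f) (parcs G)"
    using map_prod_inj_on[OF inj inj] by (rule inj_on_subset) (auto dest: wellformed')
  then have "pre_digraph.digraph_isomorphism (with_proj G) ?h"
    using inj wf_digraph by (simp add: pre_digraph.digraph_isomorphism_def)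
  ultimately show "\<exists>h. pre_digraph.digraph_isomorphism (with_proj G) h \<and>
      app_iso h (with_proj G) = with_proj G \<and> iso_verts h = f"
    by (intro exI[of _ ?h]) simp
next
  interpret pair_graph G by fact
  assume "\<exists>h. pre_digraph.digraph_isomorphism (with_proj G) h \<and>
    app_iso h (with_proj G) = with_proj G \<and> iso_verts h = f"
  then obtain h where h: "pre_digraph.digraph_isomorphism (with_proj G) h"
    and eq: "app_iso h (with_proj G) = with_proj G" and f: "iso_verts h = f" by blast
  from eq have im: "f ` pverts G = pverts G" and ar: "iso_arcs h ` parcs G = parcs G"
    and t: "iso_tail h = fst" and hd: "iso_head h = snd"
    by (simp_all add: app_iso_def with_proj_def f)
  from h have inj: "inj_on f (pverts G)"
    and m: "\<And>u v. (u, v) \<in> parcs G \<Longrightarrow> iso_arcs h (u, v) = (f u, f v)"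
    by (auto simp: pre_digraph.digraph_isomorphism_def f t hd prod_eq_iff)
  have "(u, v) \<in> parcs G \<longleftrightarrow> (f u, f v) \<in> parcs G" if "u \<in> pverts G" "v \<in> pverts G" for u v
  proof
    assume "(u, v) \<in> parcs G"
    then show "(f u, f v) \<in> parcs G" using m ar by (metis imageI)
  next
    assume "(f u, f v) \<in> parcs G"
    then obtain u' v' where "(u', v') \<in> parcs G" "(f u, f v) = (f u', f v')"
      using ar m by (metis imageE surj_pair)
    moreover from this have "u = u'" "v = v'"
      using inj that wellformed'[of u' v'] by (simp_all add: inj_on_eq_iff)
    ultimately show "(u, v) \<in> parcs G" by simp
  qed
  with inj im show "automorphism G f" by (auto simp: automorphism_def bij_betw_def)
qed

end

theory Submission
  imports Defs
begin

text \<open>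
  In a perfect matching with \<open>m\<close> edges, choosing one endpoint of every edge gives a fixing set, as
  the other endpoint is the only neighbour of the chosen one. On the other hand, exchanging the
  endpoints of a single edge is an automorphism, so a set that misses both of them is not fixing.
  Hence the fixing number is at most \<open>m\<close> while the fixed number exceeds \<open>2 * m - 2\<close>.
\<close>

definition matching_graph :: "nat \<Rightarrow> nat pair_pre_digraph" where
  "matching_graph m =
     \<lparr> pverts = {..<2 * m}, parcs = {(u, v). u < 2 * m \<and> v < 2 * m \<and> (v = u + m \<or> u = v + m)} \<rparr>"

lemma pverts_matching_graph [simp]: "pverts (matching_graph m) = {..<2 * m}"
  by (simp add: matching_graph_def)

lemma parcs_matching_graph [simp]:
  "(u, v) \<in> parcs (matching_graph m) \<longleftrightarrow>
     u < 2 * m \<and> v < 2 * m \<and> (v = u + m \<or> u = v + m)"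
  by (simp add: matching_graph_def)

lemma pair_graph_matching_graph:
  assumes "m \<ge> 1"
  shows "pair_graph (matching_graph m)"
proof
  have "parcs (matching_graph m) \<subseteq> {..<2 * m} \<times> {..<2 * m}"
    by auto
  then show "finite (parcs (matching_graph m))"
    by (rule finite_subset) simp
  show "symmetric (with_proj (matching_graph m))"
    by (auto simp: symmetric_def arcs_ends_def arc_to_ends_def sym_def)
qed (use assms in auto)

lemma fixing_number_le:
  assumes "fixing_set G D"
  shows "fixing_number G \<le> card D"
  unfolding fixing_number_def using assms by (intro Least_le) blast

text \<open>If \<open>fixed_number G \<le> card D\<close>, some subset of \<open>D\<close> has
  exactly that cardinality and so is fixing; but \<open>f\<close> fixes it pointwise without being
  the identity.\<close>

lemma less_fixed_numberI:
  assumes fin: "finite (pverts G)" and D: "D \<subseteq> pverts G"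
    and f: "automorphism G f" "\<forall>v\<in>D. f v = v" "\<exists>v\<in>pverts G. f v \<noteq> v"
  shows "card D < fixed_number G"
proof (rule ccontr)
  assume "\<not> card D < fixed_number G"
  then obtain E where E: "E \<subseteq> D" "card E = fixed_number G"
    by (metis not_less obtain_subset_with_card_n)
  have "\<forall>E. E \<subseteq> pverts G \<and> card E = fixed_number G \<longrightarrow> fixing_set G E"
    unfolding fixed_number_def
    \<comment> \<open>The minimum is attained: only the full vertex set has cardinality
      \<open>card (pverts G)\<close>.\<close>
    by (rule LeastI[of _ "card (pverts G)"]) (use fin card_subset_eq fixing_set_pverts in blast)
  with E D have "fixing_set G E" by blast
  with f E(1) show False unfolding fixing_set_def by blast
qed

lemma fixing_number_matching_graph_le: "fixing_number (matching_graph m) \<le> m"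
proof -
  have "f v = v" if f: "automorphism (matching_graph m) f" "\<forall>v\<in>{..<m}. f v = v" and v: "v < 2 * m"
    for f v
  proof (cases "v < m")
    case False
    \<comment> \<open>\<open>f v\<close> is adjacent to the fixed vertex \<open>v - m\<close>, whose
      only neighbour is \<open>v\<close>.\<close>
    with v have u: "v - m < m" "(v - m, v) \<in> parcs (matching_graph m)" by auto
    then have "(f (v - m), f v) \<in> parcs (matching_graph m)"
      using f(1) v unfolding automorphism_def pverts_matching_graph
      by (metis less_imp_diff_less lessThan_iff)
    moreover have "f (v - m) = v - m" using f(2) u(1) by simp
    ultimately show ?thesis using u(1) False by auto
  qed (use f in simp)
  then have "fixing_set (matching_graph m) {..<m}"
    by (auto simp: fixing_set_def)
  then show ?thesis
    using fixing_number_le by fastforce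
qed

lemma fixed_number_matching_graph_gt:
  assumes "m \<ge> 1"
  shows "2 * m - 2 < fixed_number (matching_graph m)"
proof -
  \<comment> \<open>\<open>?f\<close> flips the edge between \<open>0\<close> and \<open>m\<close>;
    \<open>?D\<close> consists of all the vertices it fixes.\<close>
  let ?f = "transpose 0 m" and ?D = "{..<2 * m} - {0, m}"
  have "bij_betw ?f {..<2 * m} {..<2 * m}"
    using assms by (intro bij_betw_transpose_iff) auto
  then have "automorphism (matching_graph m) ?f"
    using assms by (auto simp: automorphism_def transpose_def)
  then have "card ?D < fixed_number (matching_graph m)"
    using assms by (intro less_fixed_numberI[where f = ?f]) (auto simp: transpose_def)
  moreover have "card ?D = 2 * m - 2"
    using assms by (subst card_Diff_subset) auto
  ultimately show ?thesis by simp
qed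

theorem theorem4p1:
  fixes N :: nat
  assumes "N \<ge> 1"
  shows "\<exists>G :: nat pair_pre_digraph.
    pair_graph G \<and> int (fixed_number G) - int (fixing_number G) \<ge> int N"
proof (intro exI conjI)
  \<comment> \<open>With \<open>m\<close> edges the difference is at least
    \<open>(2 * m - 1) - m = m - 1\<close>, hence \<open>m = N + 1\<close>.\<close>
  show "pair_graph (matching_graph (N + 1))"
    by (rule pair_graph_matching_graph) simp
  show "int (fixed_number (matching_graph (N + 1))) - int (fixing_number (matching_graph (N + 1))) \<ge> int N"
    using fixing_number_matching_graph_le[of "N + 1"] fixed_number_matching_graph_gt[of "N + 1"]
    by simp
qed

end
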